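(* The complete bipartite graph $K_{4,4}$ is B-factorizable.
   Context: Let $V$ be a finite set with $|V|$ even. $K=\binom{V}{2}$ is the set of 2-element subsets of $V$. An equal partition of $V$ is an unordered pair $\{H,A\}$ of disjoint subsets with $H\cup A=V$ and $|H|=|A|=|V|/2$; $C=C(V)$ is the set of equal partitions. For $c=\{H,A\}\in C$, $B_c$ is the complete bipartite graph with parts $H$ and $A$. Vectors live in $\mathbb N^{K\cup C}$ with $\mathbb N=\{0,1,2,\dots\}$; $v|_K$ denotes the restriction to coordinates in $K$. For $E\subseteq K$, $\chi_E\in\{0,1\}^K$ is its indicator vector. For $E\subseteq K$ and $c\in C$, $\chi_{E,c}\in\mathbb N^{K\cup C}$ has $K$-components $\chi_E$ and $C$-components equal to the indicator of $c$. $PM(V)=\{\chi_{q,c}: c\in C,\ q\text{ a perfect matching of }B_c\}$. For $\mathcal M\subseteq\mathbb N^{K\cup C}$, $\mathbf N(\mathcal M)$ is the set of finite nonnegative integer combinations of elements of $\mathcal M$, and $\overline{\mathbf N}(\mathcal M)=\{v\in\mathbb N^{K\cup C}: kv\in\mathbf N(\mathcal M)\text{ for some integer }k\ge1\}$. A regular graph $G=(V,E)$ is B-factorizable if every $v\in\overline{\mathbf N}(PM(V))$ with $v|_K=\chi_E$ belongs to $\mathbf N(PM(V))$. *)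

theory Defs
  imports Main
begin

definition pairs :: "'a set \<Rightarrow> 'a set set" where
  "pairs V = {e. \<exists>x y. x \<in> V \<and> y \<in> V \<and> x \<noteq> y \<and> e = {x, y}}"

definition equal_partitions :: "'a set \<Rightarrow> 'a set set set" where
  "equal_partitions V = {{H, A} | H A. H \<inter> A = {} \<and> H \<union> A = V
       \<and> card H = card V div 2 \<and> card A = card V div 2}"

definition bip_edges :: "'a set \<Rightarrow> 'a set \<Rightarrow> 'a set set" where
  "bip_edges H A = {{h, a} | h a. h \<in> H \<and> a \<in> A}"

definition Bc_edges :: "'a set set \<Rightarrow> 'a set set" where
  "Bc_edges c = {e. \<exists>H A. c = {H, A} \<and> e \<in> bip_edges H A}"

definition perfect_matching :: "'a set \<Rightarrow> 'a set set \<Rightarrow> 'a set set \<Rightarrow> bool" where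
  "perfect_matching V E q \<longleftrightarrow> q \<subseteq> E \<and> (\<forall>v\<in>V. \<exists>!e. e \<in> q \<and> v \<in> e)"

text \<open>Coordinates K \<union> C are encoded as Inl e (e \<in> K) and Inr c (c \<in> C);
  vectors in N^(K \<union> C) are nat-valued functions vanishing outside these coordinates.\<close>
type_synonym 'a coord = "'a set + 'a set set"

definition coords :: "'a set \<Rightarrow> 'a coord set" where
  "coords V = Inl ` pairs V \<union> Inr ` equal_partitions V"

definition is_vec :: "'a set \<Rightarrow> ('a coord \<Rightarrow> nat) \<Rightarrow> bool" where
  "is_vec V v \<longleftrightarrow> (\<forall>x. x \<notin> coords V \<longrightarrow> v x = 0)"

definition chi_Ec :: "'a set set \<Rightarrow> 'a set set \<Rightarrow> 'a coord \<Rightarrow> nat" where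
  "chi_Ec E c = (\<lambda>x. case x of Inl e \<Rightarrow> (if e \<in> E then 1 else 0)
                              | Inr d \<Rightarrow> (if d = c then 1 else 0))"

definition PM :: "'a set \<Rightarrow> ('a coord \<Rightarrow> nat) set" where
  "PM V = {chi_Ec q c | c q. c \<in> equal_partitions V \<and> perfect_matching V (Bc_edges c) q}"

definition int_cone :: "('b \<Rightarrow> nat) set \<Rightarrow> ('b \<Rightarrow> nat) set" where
  "int_cone M = {v. \<exists>S a. finite S \<and> S \<subseteq> M \<and> v = (\<lambda>x. \<Sum>m\<in>S. a m * m x)}"

definition sat_cone :: "'a set \<Rightarrow> ('a coord \<Rightarrow> nat) set \<Rightarrow> ('a coord \<Rightarrow> nat) set" where
  "sat_cone V M = {v. is_vec V v \<and> (\<exists>k::nat. k \<ge> 1 \<and> (\<lambda>x. k * v x) \<in> int_cone M)}"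

definition regular_graph :: "'a set \<Rightarrow> 'a set set \<Rightarrow> bool" where
  "regular_graph V E \<longleftrightarrow> E \<subseteq> pairs V \<and> (\<exists>d. \<forall>v\<in>V. card {e\<in>E. v \<in> e} = d)"

definition B_factorizable :: "'a set \<Rightarrow> 'a set set \<Rightarrow> bool" where
  "B_factorizable V E \<longleftrightarrow> regular_graph V E \<and>
     (\<forall>v \<in> sat_cone V (PM V).
        (\<forall>e \<in> pairs V. v (Inl e) = (if e \<in> E then 1 else 0)) \<longrightarrow> v \<in> int_cone (PM V))"

end

theory Submission
  imports Defs
begin

text \<open>
  Label the two sides of the graph by four indices each. An equal partition \<open>c\<close> of the eight
  vertices leaves, of the cells \<open>(i, j)\<close> of the \<open>4 \<times> 4\<close> grid of edges, exactly those with
  \<open>x i = y j\<close>, where \<open>x\<close> and \<open>y\<close> are Boolean vectors with equally many true entries. Counting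
  edges, a vector \<open>v\<close> as in the definition of B-factorizability amounts to four such patterns, and
  it lies in the integer cone iff the grid decomposes into four permutation matrices, one inside
  each pattern.

  If \<open>v\<close> only lies in the saturated cone, then linear programming duality still gives, for every
  nonnegative weight \<open>w\<close> on the cells, that the total weight is at most the sum over the four
  patterns of the largest weight of a permutation inside the pattern. It turns out that whenever
  the required decomposition does not exist, this inequality is violated by one of two simple kinds
  of weights: weights 2 and 1 on two cells of a single row or column, or weight 1 on the cells
  outside one of the four patterns. This is a finite statement, checked by evaluation after
  relabelling the vertices so that one of the patterns is in normal form.
\<close>

section \<open>Patterns and permutations of the grid\<close>

datatype idx = I1 | I2 | I3 | I4

definition idxs :: "idx list" where
  "idxs = [I1, I2, I3, I4]"

lemma UNIV_idx: "UNIV = {I1, I2, I3, I4}"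
  using idx.exhaust by auto

lemma card_UNIV_idx: "card (UNIV :: idx set) = 4"
  by (simp add: UNIV_idx)

lemma set_idxs [simp]: "set idxs = UNIV"
  by (simp add: idxs_def UNIV_idx)

instance idx :: finite
  by standard (simp add: UNIV_idx)

lemma all_idx: "(\<forall>i. P i) \<longleftrightarrow> P I1 \<and> P I2 \<and> P I3 \<and> P I4"
  using idx.exhaust by metis

lemma sum_idx: "(\<Sum>i\<in>UNIV. f i) = f I1 + (f I2 + (f I3 + f I4))"
  for f :: "idx \<Rightarrow> nat"
  by (simp add: UNIV_idx)

lemma sum_list_idxs: "(\<Sum>i\<leftarrow>idxs. f i) = (\<Sum>i\<in>UNIV. f i)"
  for f :: "idx \<Rightarrow> nat"
  by (simp add: idxs_def sum_idx)

lemma case_idx_eta: "case_idx (f I1) (f I2) (f I3) (f I4) = f"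
  by (rule ext) (simp split: idx.split)

type_synonym perm = "idx \<Rightarrow> idx"

type_synonym pattern = "(idx \<Rightarrow> bool) \<times> (idx \<Rightarrow> bool)"

definition all_perms :: "perm list" where
  "all_perms = [case_idx a b c d. a \<leftarrow> idxs, b \<leftarrow> idxs, c \<leftarrow> idxs, d \<leftarrow> idxs, distinct [a, b, c, d]]"

text \<open>Keeps the simplifier from enumerating the permutations anew at every use of the constant.\<close>

lemma all_perms_code [code]:
  "all_perms =
    [case_idx I1 I2 I3 I4, case_idx I1 I2 I4 I3, case_idx I1 I3 I2 I4,
     case_idx I1 I3 I4 I2, case_idx I1 I4 I2 I3, case_idx I1 I4 I3 I2,
     case_idx I2 I1 I3 I4, case_idx I2 I1 I4 I3, case_idx I2 I3 I1 I4,
     case_idx I2 I3 I4 I1, case_idx I2 I4 I1 I3, case_idx I2 I4 I3 I1,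
     case_idx I3 I1 I2 I4, case_idx I3 I1 I4 I2, case_idx I3 I2 I1 I4,
     case_idx I3 I2 I4 I1, case_idx I3 I4 I1 I2, case_idx I3 I4 I2 I1,
     case_idx I4 I1 I2 I3, case_idx I4 I1 I3 I2, case_idx I4 I2 I1 I3,
     case_idx I4 I2 I3 I1, case_idx I4 I3 I1 I2, case_idx I4 I3 I2 I1]"
  by (simp add: all_perms_def idxs_def)

lemma set_all_perms: "set all_perms = {q. inj q}"
proof -
  have inj_iff: "inj q \<longleftrightarrow> distinct [q I1, q I2, q I3, q I4]" for q :: perm
    unfolding inj_def all_idx by (simp add: eq_commute) argo
  have set_eq: "set all_perms = {case_idx a b c d | a b c d. distinct [a, b, c, d]}"
    unfolding all_perms_def by (simp del: distinct.simps distinct_length_2_or_more) (blast intro: set_eqI)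
  have "q \<in> set all_perms" if "inj q" for q
    using that case_idx_eta[of q] unfolding inj_iff set_eq by (metis (mono_tags, lifting) mem_Collect_eq)
  moreover have "inj q" if "q \<in> set all_perms" for q
  proof -
    obtain a b c d where "q = case_idx a b c d" "distinct [a, b, c, d]"
      using \<open>q \<in> set all_perms\<close> unfolding set_eq by blast
    then show ?thesis unfolding inj_iff by (simp only: idx.case)
  qed
  ultimately have "q \<in> set all_perms \<longleftrightarrow> q \<in> {q. inj q}" for q
    unfolding mem_Collect_eq by (rule iffI[rotated])
  then show ?thesis by (rule set_eqI)
qed

definition weight_true :: "(idx \<Rightarrow> bool) \<Rightarrow> nat" where
  "weight_true x = (\<Sum>i\<leftarrow>idxs. of_bool (x i))"

definition bool_vectors :: "(idx \<Rightarrow> bool) list" where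
  "bool_vectors = [case_idx a b c d. a \<leftarrow> [True, False], b \<leftarrow> [True, False],
     c \<leftarrow> [True, False], d \<leftarrow> [True, False]]"

text \<open>The pairs \<open>(x, y)\<close> and \<open>(\<not> x, \<not> y)\<close> allow the same cells, hence the condition \<open>x I1\<close>.\<close>

definition patterns :: "pattern list" where
  "patterns = [(x, y). x \<leftarrow> bool_vectors, y \<leftarrow> bool_vectors, x I1, weight_true x = weight_true y]"

lemma set_patterns: "set patterns = {(x, y). x I1 \<and> weight_true x = weight_true y}"
proof -
  have "x \<in> set bool_vectors" for x
  proof -
    have "case_idx (x I1) (x I2) (x I3) (x I4) \<in> set bool_vectors"
      unfolding bool_vectors_def by (cases "x I1"; cases "x I2"; cases "x I3"; cases "x I4") simp_all
    then show ?thesis by (simp only: case_idx_eta)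
  qed
  then show ?thesis unfolding patterns_def by (auto split: if_splits)
qed

definition fits :: "pattern \<Rightarrow> perm \<Rightarrow> bool" where
  "fits p q \<longleftrightarrow> (\<forall>i. fst p i = snd p (q i))"

text \<open>The code equations below use \<open>if\<close> because the simplifier evaluates both arguments of \<open>\<and>\<close>.\<close>

lemma fits_code [code]:
  "fits (x, y) q = (if x I1 = y (q I1) then if x I2 = y (q I2) then if x I3 = y (q I3)
     then x I4 = y (q I4) else False else False else False)"
  by (auto simp: fits_def all_idx)

definition avoids :: "perm \<Rightarrow> perm \<Rightarrow> bool" where
  "avoids q r \<longleftrightarrow> (\<forall>i. q i \<noteq> r i)"

lemma avoids_code [code]:
  "avoids q r = (if q I1 = r I1 then False else if q I2 = r I2 then False
     else if q I3 = r I3 then False else q I4 \<noteq> r I4)"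
  by (auto simp: avoids_def all_idx)

lemma avoids_sym: "avoids q r \<Longrightarrow> avoids r q"
  unfolding avoids_def by metis

section \<open>Weights of permutations, decompositions and obstructions\<close>

definition weight :: "(idx \<Rightarrow> idx \<Rightarrow> nat) \<Rightarrow> perm \<Rightarrow> nat" where
  "weight w q = (\<Sum>i\<leftarrow>idxs. w i (q i))"

lemma weight_code [code]:
  "weight w q = w I1 (q I1) + (w I2 (q I2) + (w I3 (q I3) + w I4 (q I4)))"
  by (simp add: weight_def idxs_def)

definition total_weight :: "(idx \<Rightarrow> idx \<Rightarrow> nat) \<Rightarrow> nat" where
  "total_weight w = (\<Sum>i\<leftarrow>idxs. \<Sum>j\<leftarrow>idxs. w i j)"

text \<open>Four pairwise disjoint permutations occupy 4 * 4 = 16 cells, so they partition the grid: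
  this is the decomposition of the all-ones matrix into permutation matrices inside the four
  patterns.\<close>

definition solvable :: "pattern \<Rightarrow> pattern \<Rightarrow> pattern \<Rightarrow> pattern \<Rightarrow> bool" where
  "solvable p0 p1 p2 p3 \<longleftrightarrow> (\<exists>q0 q1 q2 q3. inj q0 \<and> inj q1 \<and> inj q2 \<and> inj q3
     \<and> fits p0 q0 \<and> fits p1 q1 \<and> fits p2 q2 \<and> fits p3 q3
     \<and> avoids q0 q1 \<and> avoids q0 q2 \<and> avoids q0 q3 \<and> avoids q1 q2 \<and> avoids q1 q3 \<and> avoids q2 q3)"

text \<open>The pair \<open>w\<close>, \<open>b\<close> is a dual certificate. The bound is required
  for every pattern, since a cone representation may a priori use any partition.\<close>

definition obstructed :: "pattern \<Rightarrow> pattern \<Rightarrow> pattern \<Rightarrow> pattern \<Rightarrow> bool" where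
  "obstructed p0 p1 p2 p3 \<longleftrightarrow> (\<exists>w b. (\<forall>p q. inj q \<longrightarrow> fits p q \<longrightarrow> weight w q \<le> b p)
     \<and> b p0 + b p1 + b p2 + b p3 < total_weight w)"

definition decided :: "pattern \<Rightarrow> pattern \<Rightarrow> pattern \<Rightarrow> pattern \<Rightarrow> bool" where
  "decided p0 p1 p2 p3 \<longleftrightarrow> solvable p0 p1 p2 p3 \<or> obstructed p0 p1 p2 p3"

text \<open>With \<open>decided_swap23\<close> this generates all reorderings of the last three
  patterns, so the search can treat these as a multiset.\<close>

lemma decided_swap12:
  assumes "decided p0 p1 p2 p3"
  shows "decided p0 p2 p1 p3"
  using assms unfolding decided_def
proof
  assume "solvable p0 p1 p2 p3"
  then obtain q0 q1 q2 q3 where "inj q0" "inj q1" "inj q2" "inj q3"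
    "fits p0 q0" "fits p1 q1" "fits p2 q2" "fits p3 q3"
    "avoids q0 q1" "avoids q0 q2" "avoids q0 q3" "avoids q1 q2" "avoids q1 q3" "avoids q2 q3"
    unfolding solvable_def by blast
  then have "solvable p0 p2 p1 p3"
    unfolding solvable_def
    by (intro exI[of _ q0] exI[of _ q2] exI[of _ q1] exI[of _ q3]) (simp add: avoids_sym)
  then show "solvable p0 p2 p1 p3 \<or> obstructed p0 p2 p1 p3" ..
qed (simp add: obstructed_def add_ac)

lemma decided_swap23:
  assumes "decided p0 p1 p2 p3"
  shows "decided p0 p1 p3 p2"
  using assms unfolding decided_def
proof
  assume "solvable p0 p1 p2 p3"
  then obtain q0 q1 q2 q3 where "inj q0" "inj q1" "inj q2" "inj q3"
    "fits p0 q0" "fits p1 q1" "fits p2 q2" "fits p3 q3"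
    "avoids q0 q1" "avoids q0 q2" "avoids q0 q3" "avoids q1 q2" "avoids q1 q3" "avoids q2 q3"
    unfolding solvable_def by blast
  then have "solvable p0 p1 p3 p2"
    unfolding solvable_def
    by (intro exI[of _ q0] exI[of _ q1] exI[of _ q3] exI[of _ q2]) (simp add: avoids_sym)
  then show "solvable p0 p1 p3 p2 \<or> obstructed p0 p1 p3 p2" ..
qed (simp add: obstructed_def add_ac)

definition perms_of :: "pattern \<Rightarrow> perm list" where
  "perms_of p = filter (fits p) all_perms"

lemma set_perms_of: "set (perms_of p) = {q. inj q \<and> fits p q}"
  by (auto simp: perms_of_def set_all_perms)

section \<open>Deciding all quadruples of patterns\<close>

text \<open>The last two permutations are not yet tested against patterns, so one list serves all
  choices of \<open>p2\<close> and \<open>p3\<close>. The one-element list around \<open>qs\<close>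
  only acts as a local binding.\<close>

definition completions :: "pattern \<Rightarrow> pattern \<Rightarrow> (perm \<times> perm) list" where
  "completions p0 p1 = [(q2, q3). q0 \<leftarrow> perms_of p0, q1 \<leftarrow> filter (avoids q0) (perms_of p1),
     qs \<leftarrow> [filter (avoids q0) (filter (avoids q1) all_perms)], q2 \<leftarrow> qs, q3 \<leftarrow> filter (avoids q2) qs]"

lemma completionsD:
  assumes "(q2, q3) \<in> set (completions p0 p1)" "fits p2 q2" "fits p3 q3"
  shows "solvable p0 p1 p2 p3"
  using assms unfolding completions_def solvable_def
  by (auto simp: set_perms_of set_all_perms)

fun fourths :: "pattern \<Rightarrow> (perm \<times> perm) list \<Rightarrow> perm list" where
  "fourths p [] = []"
| "fourths p (a # as) = (case a of (q, r) \<Rightarrow> if fits p q then r # fourths p as else fourths p as)"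

lemma fourthsD: "r \<in> set (fourths p as) \<Longrightarrow> \<exists>q. (q, r) \<in> set as \<and> fits p q"
  by (induction as) (auto split: if_splits)

fun some_fits :: "pattern \<Rightarrow> perm list \<Rightarrow> bool" where
  "some_fits p [] = False"
| "some_fits p (q # qs) = (if fits p q then True else some_fits p qs)"

lemma some_fitsD: "some_fits p qs \<Longrightarrow> \<exists>q \<in> set qs. fits p q"
  by (induction qs) (auto split: if_splits)

section \<open>Weights supported on two cells of a row or column\<close>

datatype line = Row idx idx idx | Col idx idx idx

fun line_weight :: "line \<Rightarrow> idx \<Rightarrow> idx \<Rightarrow> nat" where
  "line_weight (Row i j k) = (\<lambda>g h. if g = i then (if h = j then 2 else if h = k then 1 else 0) else 0)"
| "line_weight (Col i j k) = (\<lambda>g h. if h = i then (if g = j then 2 else if g = k then 1 else 0) else 0)"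

fun line_bound :: "line \<Rightarrow> pattern \<Rightarrow> nat" where
  "line_bound (Row i j k) (x, y) = (if x i = y j then Suc (Suc 0) else if x i = y k then Suc 0 else 0)"
| "line_bound (Col i j k) (x, y) = (if x j = y i then Suc (Suc 0) else if x k = y i then Suc 0 else 0)"

text \<open>A permutation meets each row and each column in exactly one cell, so its weight is the
  entry of that cell, and the pattern decides which cells can occur.\<close>

lemma weight_line_le:
  assumes "inj q" "fits p q"
  shows "weight (line_weight l) q \<le> line_bound l p"
proof (cases p)
  case (Pair x y)
  have fit: "x i = y (q i)" for i
    using assms(2) Pair by (simp add: fits_def)
  show ?thesis
  proof (cases l)
    case (Row i j k)
    then have "weight (line_weight l) q = (if q i = j then 2 else if q i = k then 1 else 0)"
      by (simp add: weight_def sum_list_idxs)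
    then show ?thesis using fit[of i] by (auto simp: Row Pair)
  next
    case (Col i j k)
    have "surj q" using assms(1) by (simp add: finite_UNIV_inj_surj)
    then obtain g where g: "q g = i" by (metis surjD)
    then have "q g' = i \<longleftrightarrow> g' = g" for g'
      using assms(1) by (auto dest: injD)
    then have "weight (line_weight l) q = (if g = j then 2 else if g = k then 1 else 0)"
      by (simp add: weight_def sum_list_idxs Col)
    then show ?thesis using fit[of g] by (auto simp: Col Pair g)
  qed
qed

text \<open>Each line is paired with the total weight 3 that the four patterns together must reach.\<close>

definition lines :: "(line \<times> nat) list" where
  "lines = [(l, 3). i \<leftarrow> idxs, j \<leftarrow> idxs, k \<leftarrow> idxs, j \<noteq> k, l \<leftarrow> [Row i j k, Col i j k]]"

lemma linesD:
  assumes "(l, n) \<in> set lines"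
  shows "n = total_weight (line_weight l)"
proof -
  have line_sum: "(\<Sum>h\<in>UNIV. if h = j then 2 else if h = k then 1 else (0::nat)) = 3" if "j \<noteq> k" for j k :: idx
  proof -
    have "(\<Sum>h\<in>UNIV. if h = j then 2 else if h = k then 1 else (0::nat))
        = (\<Sum>h\<in>UNIV. (if h = j then 2 else 0) + (if h = k then 1 else 0))"
      using that by (intro sum.cong) auto
    then show ?thesis by (simp add: sum.distrib)
  qed
  have if_sum: "(\<Sum>h\<in>UNIV. if b then f h else 0) = (if b then \<Sum>h\<in>UNIV. f h else (0::nat))" for b and f :: "idx \<Rightarrow> nat"
    by simp
  obtain i j k where "j \<noteq> k" "n = 3" "l = Row i j k \<or> l = Col i j k"
    using assms by (auto simp: lines_def split: if_splits)
  then show ?thesis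
    unfolding total_weight_def sum_list_idxs
    by (elim disjE) (simp_all add: if_sum line_sum)
qed

text \<open>A line whose target is reached cannot be violated after adding further nonnegative
  bounds, so it is dropped; on the remaining lines the natural-number subtraction is exact.\<close>

fun deficits :: "pattern \<Rightarrow> (line \<times> nat) list \<Rightarrow> (line \<times> nat) list" where
  "deficits p [] = []"
| "deficits p (a # as) = (case a of (l, n) \<Rightarrow>
     if line_bound l p < n then (l, n - line_bound l p) # deficits p as else deficits p as)"

lemma deficitsD: "(l, n) \<in> set (deficits p as) \<Longrightarrow> (l, line_bound l p + n) \<in> set as"
  by (induction as) (auto split: if_splits)

fun short :: "pattern \<Rightarrow> (line \<times> nat) list \<Rightarrow> bool" where
  "short p [] = False"
| "short p (a # as) = (case a of (l, n) \<Rightarrow> if line_bound l p < n then True else short p as)"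

lemma shortD: "short p as \<Longrightarrow> \<exists>l n. (l, n) \<in> set as \<and> line_bound l p < n"
  by (induction as) (auto split: if_splits)

lemma obstructed_if_short:
  assumes "short p3 (deficits p2 (deficits p1 (deficits p0 lines)))"
  shows "obstructed p0 p1 p2 p3"
proof -
  obtain l n where "(l, n) \<in> set (deficits p2 (deficits p1 (deficits p0 lines)))" "line_bound l p3 < n"
    using shortD[OF assms] by blast
  then have "line_bound l p0 + line_bound l p1 + line_bound l p2 + line_bound l p3 < total_weight (line_weight l)"
    by (auto dest!: deficitsD linesD)
  then show ?thesis
    using weight_line_le unfolding obstructed_def by blast
qed

section \<open>Weights supported outside a pattern\<close>

fun outside :: "pattern \<Rightarrow> idx \<Rightarrow> idx \<Rightarrow> nat" where
  "outside (x, y) i j = (if x i = y j then 0 else Suc 0)"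

definition max_outside :: "pattern \<Rightarrow> pattern \<Rightarrow> nat" where
  "max_outside s p = fold max (map (weight (outside s)) (perms_of p)) 0"

lemma weight_outside_le:
  assumes "inj q" "fits p q"
  shows "weight (outside s) q \<le> max_outside s p"
proof -
  have "m \<le> fold max xs m \<and> (\<forall>x\<in>set xs. x \<le> fold max xs m)" for xs and m :: nat
    by (induction xs arbitrary: m) (auto simp del: max.bounded_iff, (metis max.bounded_iff)+)
  then show ?thesis
    using assms by (simp add: max_outside_def set_perms_of)
qed

text \<open>When \<open>s\<close> is one of the four patterns, its own term is 0, so the other three
  would have to cover all cells outside \<open>s\<close>.\<close>

definition blocks :: "pattern \<Rightarrow> pattern \<Rightarrow> pattern \<Rightarrow> pattern \<Rightarrow> pattern \<Rightarrow> bool" where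
  "blocks s p0 p1 p2 p3 \<longleftrightarrow>
     max_outside s p0 + max_outside s p1 + max_outside s p2 + max_outside s p3 < total_weight (outside s)"

lemma obstructed_if_blocks: "blocks s p0 p1 p2 p3 \<Longrightarrow> obstructed p0 p1 p2 p3"
  using weight_outside_le unfolding obstructed_def blocks_def by blast

text \<open>The arguments \<open>qs\<close> and \<open>ds\<close> carry what depends on the first three patterns only: the possible
  fourth permutations, and the line weights these patterns leave to the fourth one.\<close>

definition decide :: "pattern \<Rightarrow> pattern \<Rightarrow> pattern \<Rightarrow> perm list \<Rightarrow> (line \<times> nat) list \<Rightarrow> pattern \<Rightarrow> bool" where
  "decide p0 p1 p2 qs ds p = (if some_fits p qs then True else if short p ds then True
     else if blocks p0 p0 p1 p2 p then True else if blocks p1 p0 p1 p2 p then True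
     else if blocks p2 p0 p1 p2 p then True else blocks p p0 p1 p2 p)"

text \<open>Being decided is symmetric in the last three patterns, so each check restricts the later patterns
  to the part of the list starting at the current one.\<close>

fun check4 :: "pattern \<Rightarrow> pattern \<Rightarrow> pattern \<Rightarrow> perm list \<Rightarrow> (line \<times> nat) list \<Rightarrow> pattern list \<Rightarrow> bool" where
  "check4 p0 p1 p2 qs ds [] = True"
| "check4 p0 p1 p2 qs ds (p # ps) =
     (if decide p0 p1 p2 qs ds p then check4 p0 p1 p2 qs ds ps else False)"

fun check3 :: "pattern \<Rightarrow> pattern \<Rightarrow> (perm \<times> perm) list \<Rightarrow> (line \<times> nat) list \<Rightarrow> pattern list \<Rightarrow> bool" where
  "check3 p0 p1 cs ds [] = True"
| "check3 p0 p1 cs ds (p # ps) =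
     (if check4 p0 p1 p (fourths p cs) (deficits p ds) (p # ps) then check3 p0 p1 cs ds ps else False)"

fun check2 :: "pattern \<Rightarrow> (line \<times> nat) list \<Rightarrow> pattern list \<Rightarrow> bool" where
  "check2 p0 ds [] = True"
| "check2 p0 ds (p # ps) =
     (if check3 p0 p (completions p0 p) (deficits p ds) (p # ps) then check2 p0 ds ps else False)"

lemma if_else_FalseD:
  assumes "if a then b else False"
  shows a b
  using assms by argo+

text \<open>Every successful branch of \<open>decide\<close> carries a certificate: a fitting fourth
  permutation comes from a pair in \<open>completions\<close>, and the other branches give a line
  weight or an outside weight.\<close>

lemma check4D:
  assumes "check4 p0 p1 p2 (fourths p2 (completions p0 p1)) (deficits p2 (deficits p1 (deficits p0 lines))) ps"
    and "p3 \<in> set ps"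
  shows "decided p0 p1 p2 p3"
proof -
  have "decide p0 p1 p2 (fourths p2 (completions p0 p1)) (deficits p2 (deficits p1 (deficits p0 lines))) p3"
    using assms by (induction ps) (auto split: if_splits)
  then show ?thesis
    unfolding decide_def decided_def
    by (auto split: if_splits dest!: some_fitsD fourthsD
        intro: completionsD obstructed_if_short obstructed_if_blocks)
qed

text \<open>If \<open>p2\<close> or \<open>p3\<close> is the head of the list, the pass started
  there has seen the other one, and a swap restores the order; otherwise both lie in the
  tail.\<close>

lemma check3D:
  assumes "check3 p0 p1 (completions p0 p1) (deficits p1 (deficits p0 lines)) ps"
    and "p2 \<in> set ps" "p3 \<in> set ps"
  shows "decided p0 p1 p2 p3"
  using assms
proof (induction ps)
  case (Cons p ps)
  have "check4 p0 p1 p (fourths p (completions p0 p1)) (deficits p (deficits p1 (deficits p0 lines))) (p # ps)"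
    and rest: "check3 p0 p1 (completions p0 p1) (deficits p1 (deficits p0 lines)) ps"
    using Cons.prems(1) unfolding check3.simps(2) by (fact if_else_FalseD)+
  from check4D[OF this(1)] have first: "p' \<in> set (p # ps) \<Longrightarrow> decided p0 p1 p p'" for p' .
  consider "p2 = p" | "p3 = p" | "p2 \<in> set ps" "p3 \<in> set ps"
    using Cons.prems(2,3) by auto
  then show ?case
  proof cases
    case 1
    then show ?thesis using first[OF Cons.prems(3)] by simp
  next
    case 2
    then show ?thesis using decided_swap23[OF first[OF Cons.prems(2)]] by simp
  next
    case 3
    then show ?thesis by (rule Cons.IH[OF rest])
  qed
qed simp

text \<open>The argument of \<open>check3D\<close> with three patterns: whichever of them is the
  head is moved to the front by swaps.\<close>

lemma check2D:
  assumes "check2 p0 (deficits p0 lines) ps" and "p1 \<in> set ps" "p2 \<in> set ps" "p3 \<in> set ps"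
  shows "decided p0 p1 p2 p3"
  using assms
proof (induction ps)
  case (Cons p ps)
  have "check3 p0 p (completions p0 p) (deficits p (deficits p0 lines)) (p # ps)"
    and rest: "check2 p0 (deficits p0 lines) ps"
    using Cons.prems(1) unfolding check2.simps(2) by (fact if_else_FalseD)+
  from check3D[OF this(1)]
  have first: "p' \<in> set (p # ps) \<Longrightarrow> p'' \<in> set (p # ps) \<Longrightarrow> decided p0 p p' p''" for p' p'' .
  consider "p1 = p" | "p2 = p" | "p3 = p" | "p1 \<in> set ps" "p2 \<in> set ps" "p3 \<in> set ps"
    using Cons.prems(2-4) by auto
  then show ?case
  proof cases
    case 1
    then show ?thesis using first[OF Cons.prems(3,4)] by simp
  next
    case 2
    then show ?thesis using decided_swap12[OF first[OF Cons.prems(2,4)]] by simp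
  next
    case 3
    then show ?thesis using decided_swap23[OF decided_swap12[OF first[OF Cons.prems(2,3)]]] by simp
  next
    case 4
    then show ?thesis by (rule Cons.IH[OF rest])
  qed
qed simp

text \<open>The normal form of a pattern of weight \<open>n\<close> when the indices of the two
  sides may be permuted independently.\<close>

definition staircase :: "nat \<Rightarrow> pattern" where
  "staircase n = (case_idx (0 < n) (1 < n) (2 < n) (3 < n), case_idx (0 < n) (1 < n) (2 < n) (3 < n))"

text \<open>Replacing \<open>(x, y)\<close> by its negation turns the weight \<open>m\<close> of \<open>x\<close> into \<open>4 - m\<close>; the first pattern is
  taken with the smallest value of the maximum of the two.\<close>

definition patterns_from :: "nat \<Rightarrow> pattern list" where
  "patterns_from n = filter (\<lambda>p. n \<le> max (weight_true (fst p)) (4 - weight_true (fst p))) patterns"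


text \<open>For m \<le> 4 the maximum of m and 4 - m lies between 2 and 4, so three runs cover all
  normal forms.\<close>

lemma check_staircase_2: "check2 (staircase 2) (deficits (staircase 2) lines) (patterns_from 2)"
  by code_simp

lemma check_staircase_3: "check2 (staircase 3) (deficits (staircase 3) lines) (patterns_from 3)"
  by code_simp

lemma check_staircase_4: "check2 (staircase 4) (deficits (staircase 4) lines) (patterns_from 4)"
  by code_simp

section \<open>Cones and equal partitions\<close>

definition position :: "idx \<Rightarrow> nat" where
  "position = case_idx 0 1 2 3"

lemma bij_betw_position: "bij_betw position UNIV {..<4}"
proof -
  have "{..<4} = {0, 1, 2, 3 :: nat}" by auto
  moreover have "inj position"
    by (rule injI) (auto simp: position_def split: idx.splits)
  ultimately show ?thesis
    by (auto simp: bij_betw_def UNIV_idx position_def)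
qed

lemma staircase_position: "staircase n = (\<lambda>i. position i < n, \<lambda>j. position j < n)"
  by (auto simp: staircase_def position_def fun_eq_iff split: idx.split)

text \<open>List the elements of \<open>X\<close> inside \<open>P\<close> first and the others
  afterwards; positions in this list are the labels.\<close>

lemma enumerate_initial:
  assumes "card X = 4"
  obtains r where "bij_betw r UNIV X" "\<And>i. r i \<in> P \<longleftrightarrow> position i < card (X \<inter> P)"
proof -
  have fin: "finite X" using assms by (simp add: card_ge_0_finite)
  obtain xs where xs: "set xs = X \<inter> P" "distinct xs"
    using fin finite_distinct_list[of "X \<inter> P"] by auto
  obtain ys where ys: "set ys = X - P" "distinct ys"
    using fin finite_distinct_list[of "X - P"] by auto
  define zs where "zs = xs @ ys"
  have zs: "set zs = X" "distinct zs" using xs ys by (auto simp: zs_def)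
  then have len: "length zs = 4" using assms distinct_card[of zs] by simp
  have lenx: "length xs = card (X \<inter> P)" using xs distinct_card[of xs] by simp
  have "bij_betw ((!) zs) {..<4} X"
    by (rule bij_betw_nth) (simp_all add: zs len)
  then have "bij_betw ((!) zs \<circ> position) UNIV X"
    by (rule bij_betw_trans[OF bij_betw_position])
  moreover have "zs ! position i \<in> P \<longleftrightarrow> position i < card (X \<inter> P)" for i
  proof -
    have "position i < length zs"
      using bij_betw_position len by (auto simp: bij_betw_def)
    then have less: "\<not> position i < length xs \<Longrightarrow> position i - length xs < length ys"
      by (simp add: zs_def)
    show ?thesis
    proof (cases "position i < length xs")
      case True
      then have "zs ! position i \<in> X \<inter> P"
        using nth_mem[OF True] xs(1) by (simp add: zs_def nth_append)
      then show ?thesis using True lenx by simp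
    next
      case False
      then have "zs ! position i \<in> X - P"
        using nth_mem[OF less[OF False]] ys(1) by (simp add: zs_def nth_append)
      then show ?thesis using False lenx by simp
    qed
  qed
  ultimately show ?thesis using that[of "(!) zs \<circ> position"] by simp
qed

lemma weight_true_eq_card:
  assumes "bij_betw r UNIV X"
  shows "weight_true (\<lambda>i. r i \<in> P) = card (X \<inter> P)"
proof -
  have "weight_true (\<lambda>i. r i \<in> P) = card {i. r i \<in> P}"
    unfolding weight_true_def sum_list_idxs by (subst sum_of_bool_eq) simp_all
  also have "\<dots> = card (r ` {i. r i \<in> P})"
    using assms by (intro card_image[symmetric] inj_on_subset[OF bij_betw_imp_inj_on]) auto
  also have "r ` {i. r i \<in> P} = range r \<inter> P"
    by blast
  also have "range r = X"
    using assms by (rule bij_betw_imp_surj_on)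
  finally show ?thesis .
qed

text \<open>The list repeats each \<open>c\<close> exactly \<open>f c\<close> times. Quantifying
  over all \<open>b\<close> records these multiplicities in the form in which they are used
  later.\<close>

lemma exists_list_of_multiplicities:
  fixes f :: "'b \<Rightarrow> nat"
  assumes "finite F"
  shows "\<exists>cs. set cs \<subseteq> F \<and> (\<forall>b :: 'b \<Rightarrow> nat. (\<Sum>c\<in>F. b c * f c) = (\<Sum>c\<leftarrow>cs. b c))"
  using assms
proof induction
  case (insert x F)
  then obtain cs where cs: "set cs \<subseteq> F" "\<forall>b :: 'b \<Rightarrow> nat. (\<Sum>c\<in>F. b c * f c) = (\<Sum>c\<leftarrow>cs. b c)"
    by blast
  show ?case
    by (rule exI[of _ "replicate (f x) x @ cs"])
      (use insert cs in \<open>auto simp: sum_list_replicate mult.commute\<close>)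
qed (auto intro: exI[of _ "[]"])

section \<open>Building elements of the integer cone\<close>

lemma zero_in_int_cone: "(\<lambda>x. 0) \<in> int_cone M"
  unfolding int_cone_def by (rule CollectI, rule exI[of _ "{}"]) simp

lemma add_generator_in_int_cone:
  assumes "m \<in> M" "u \<in> int_cone M"
  shows "(\<lambda>x. m x + u x) \<in> int_cone M"
proof -
  obtain S a where S: "finite S" "S \<subseteq> M" and u: "u = (\<lambda>x. \<Sum>m\<in>S. a m * m x)"
    using assms(2) unfolding int_cone_def by blast
  \<comment> \<open>The coefficients \<open>a\<close> are arbitrary outside \<open>S\<close>, so
    they are cut off there; a generator \<open>m\<close> not in \<open>S\<close> then gets
    coefficient exactly 1.\<close>
  define a' where "a' = (\<lambda>n. (if n \<in> S then a n else 0) + (if n = m then 1 else 0))"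
  have "m x + u x = (\<Sum>n\<in>insert m S. a' n * n x)" for x
  proof -
    have "(\<Sum>n\<in>insert m S. a' n * n x)
        = (\<Sum>n\<in>insert m S. if n \<in> S then a n * n x else 0) + (\<Sum>n\<in>insert m S. if n = m then n x else 0)"
      unfolding a'_def sum.distrib[symmetric] by (intro sum.cong) (auto simp: algebra_simps)
    also have "(\<Sum>n\<in>insert m S. if n = m then n x else 0) = m x"
      using S(1) by simp
    also have "(\<Sum>n\<in>insert m S. if n \<in> S then a n * n x else 0) = u x"
      unfolding u using S(1) by (intro sum.mono_neutral_cong_right) auto
    finally show ?thesis by simp
  qed
  then show ?thesis
    unfolding int_cone_def using S assms(1)
    by (intro CollectI exI[of _ "insert m S"] exI[of _ a']) auto
qed

section \<open>Equal partitions and complete bipartite graphs\<close>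

lemma finite_equal_partitions:
  assumes "finite V"
  shows "finite (equal_partitions V)"
proof (rule finite_subset)
  show "equal_partitions V \<subseteq> Pow (Pow V)" by (auto simp: equal_partitions_def)
qed (simp add: assms)

lemma doubleton_in_bip_edges_iff: "{a, b} \<in> bip_edges X Y \<longleftrightarrow> a \<in> X \<and> b \<in> Y \<or> a \<in> Y \<and> b \<in> X"
  unfolding bip_edges_def by (auto simp: doubleton_eq_iff)

lemma Bc_edges_iff:
  assumes "P \<subseteq> V"
  shows "{a, b} \<in> Bc_edges {P, V - P} \<longleftrightarrow> a \<in> V \<and> b \<in> V \<and> (a \<in> P) \<noteq> (b \<in> P)"
proof -
  have "{a, b} \<in> Bc_edges {P, V - P} \<longleftrightarrow> {a, b} \<in> bip_edges P (V - P) \<or> {a, b} \<in> bip_edges (V - P) P"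
    unfolding Bc_edges_def doubleton_eq_iff by blast
  then show ?thesis
    using assms unfolding doubleton_in_bip_edges_iff by blast
qed

lemma regular_graph_bip_edges:
  assumes "finite H" "finite A" "H \<inter> A = {}" "card H = card A"
  shows "regular_graph (H \<union> A) (bip_edges H A)"
proof -
  have "card {e \<in> bip_edges H A. v \<in> e} = card A" if "v \<in> H" for v
  proof -
    have "{e \<in> bip_edges H A. v \<in> e} = (\<lambda>a. {v, a}) ` A"
      using that assms(3) by (auto simp: bip_edges_def)
    moreover have "inj_on (\<lambda>a. {v, a}) A" by (auto simp: inj_on_def doubleton_eq_iff)
    ultimately show ?thesis by (simp add: card_image)
  qed
  moreover have "card {e \<in> bip_edges H A. v \<in> e} = card H" if "v \<in> A" for v
  proof -
    have "{e \<in> bip_edges H A. v \<in> e} = (\<lambda>h. {h, v}) ` H"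
      using that assms(3) by (auto simp: bip_edges_def)
    moreover have "inj_on (\<lambda>h. {h, v}) H" by (auto simp: inj_on_def doubleton_eq_iff)
    ultimately show ?thesis by (simp add: card_image)
  qed
  moreover have "bip_edges H A \<subseteq> pairs (H \<union> A)"
    using assms(3) unfolding bip_edges_def pairs_def by blast
  ultimately show ?thesis
    using assms(4) by (auto simp: regular_graph_def)
qed

section \<open>The complete bipartite graph with labelled sides\<close>

text \<open>The labellings are parameters because two are needed: an arbitrary one to select a
  partition, then one adapted to that partition.\<close>

locale labelled_K44 =
  fixes H A :: "'a set" and r s :: "idx \<Rightarrow> 'a"
  assumes disjoint: "H \<inter> A = {}"
    and bij_r: "bij_betw r UNIV H" and bij_s: "bij_betw s UNIV A"
begin

abbreviation "V \<equiv> H \<union> A"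

definition edge :: "idx \<Rightarrow> idx \<Rightarrow> 'a set" where
  "edge i j = {r i, s j}"

definition matching :: "perm \<Rightarrow> 'a set set" where
  "matching q = range (\<lambda>i. edge i (q i))"

text \<open>The first component is membership in the part of \<open>c\<close> that contains \<open>r I1\<close>.\<close>

definition pattern_of :: "'a set set \<Rightarrow> pattern" where
  "pattern_of c = (\<lambda>i. \<exists>P\<in>c. r I1 \<in> P \<and> r i \<in> P, \<lambda>j. \<forall>P\<in>c. r I1 \<in> P \<longrightarrow> s j \<notin> P)"

lemma r_in [simp]: "r i \<in> H" and s_in [simp]: "s j \<in> A"
  using bij_r bij_s by (auto simp: bij_betw_def)

lemma r_eq_iff [simp]: "r i = r i' \<longleftrightarrow> i = i'" and s_eq_iff [simp]: "s j = s j' \<longleftrightarrow> j = j'"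
  using bij_r bij_s by (auto simp: bij_betw_def inj_eq)

lemma r_neq_s [simp]: "r i \<noteq> s j" "s j \<noteq> r i"
  using disjoint r_in s_in by (metis disjoint_iff)+

lemma H_eq: "H = range r" and A_eq: "A = range s"
  using bij_r bij_s by (auto simp: bij_betw_def)

lemma card_H: "card H = 4" and card_A: "card A = 4"
  using bij_betw_same_card[OF bij_r] bij_betw_same_card[OF bij_s] by (simp_all add: card_UNIV_idx)

lemma finite_V: "finite V"
  by (simp add: H_eq A_eq)

lemma card_V: "card V = 8"
  using card_Un_disjoint[of H A] card_H card_A disjoint by (simp add: H_eq A_eq)

lemma edge_eq_iff [simp]: "edge i j = edge i' j' \<longleftrightarrow> i = i' \<and> j = j'"
  by (auto simp: edge_def doubleton_eq_iff)

lemma bip_edges_eq: "bip_edges H A = {edge i j | i j. True}"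
  by (auto simp: bip_edges_def H_eq A_eq edge_def)

lemma edge_in_pairs: "edge i j \<in> pairs V"
  unfolding pairs_def edge_def using r_neq_s(1) r_in s_in by blast

lemma edge_in_matching_iff: "edge i j \<in> matching q \<longleftrightarrow> q i = j"
  by (auto simp: matching_def)

lemma matching_subset: "matching q \<subseteq> bip_edges H A"
  by (auto simp: matching_def bip_edges_eq)

lemma equal_partition_obtain:
  assumes "c \<in> equal_partitions V"
  obtains P where "r I1 \<in> P" "P \<subseteq> V" "card P = 4" "c = {P, V - P}"
proof -
  obtain X Y where XY: "c = {X, Y}" "X \<inter> Y = {}" "X \<union> Y = V" "card X = 4" "card Y = 4"
    using assms by (auto simp: equal_partitions_def card_V)
  have "Y = V - X" "X = V - Y" using XY by blast+
  then have c: "c = {X, V - X}" "c = {Y, V - Y}" using XY(1) by (simp_all add: insert_commute)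
  have sub: "X \<subseteq> V" "Y \<subseteq> V" using XY(3) by blast+
  have "r I1 \<in> X \<union> Y" unfolding XY(3) by simp
  then show ?thesis
  proof
    assume "r I1 \<in> X"
    then show ?thesis by (rule that[OF _ sub(1) XY(4) c(1)])
  next
    assume "r I1 \<in> Y"
    then show ?thesis by (rule that[OF _ sub(2) XY(5) c(2)])
  qed
qed

lemma pattern_of_eq:
  assumes "P \<subseteq> V" "r I1 \<in> P"
  shows "pattern_of {P, V - P} = (\<lambda>i. r i \<in> P, \<lambda>j. s j \<notin> P)"
  using assms by (auto simp: pattern_of_def)

lemma card_split:
  assumes "P \<subseteq> V"
  shows "card P = card (H \<inter> P) + card (A \<inter> P)"
    and "card (A \<inter> - P) = 4 - card (A \<inter> P)"
    and "card (H \<inter> (V - P)) = 4 - card (H \<inter> P)"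
proof -
  have fin: "finite H" "finite A" by (simp_all add: H_eq A_eq)
  have "P = (H \<inter> P) \<union> (A \<inter> P)" using assms by blast
  then show "card P = card (H \<inter> P) + card (A \<inter> P)"
    using disjoint fin card_Un_disjoint[of "H \<inter> P" "A \<inter> P"] by (metis (no_types, lifting) Int_assoc finite_Int inf_bot_left inf_left_commute)
  have "A \<inter> - P = A - (A \<inter> P)" "H \<inter> (V - P) = H - (H \<inter> P)" by blast+
  then show "card (A \<inter> - P) = 4 - card (A \<inter> P)" "card (H \<inter> (V - P)) = 4 - card (H \<inter> P)"
    using fin by (simp_all add: card_Diff_subset card_H card_A)
qed

text \<open>The second component marks the part of \<open>A\<close> outside \<open>P\<close>, of
  size 4 - |A \<inter> P|, which equals |H \<inter> P| because |P| = 4.\<close>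

lemma weights_pattern_of:
  assumes "P \<subseteq> V" "card P = 4" "r I1 \<in> P"
  shows "weight_true (fst (pattern_of {P, V - P})) = card (H \<inter> P)"
    and "weight_true (snd (pattern_of {P, V - P})) = card (H \<inter> P)"
proof -
  show "weight_true (fst (pattern_of {P, V - P})) = card (H \<inter> P)"
    using assms by (simp add: pattern_of_eq weight_true_eq_card[OF bij_r])
  have "weight_true (\<lambda>j. s j \<notin> P) = card (A \<inter> - P)"
    using weight_true_eq_card[OF bij_s, of "- P"] by (simp only: Compl_iff)
  moreover have "card (H \<inter> P) \<le> 4" using card_mono[of H "H \<inter> P"] finite_V card_H by simp
  ultimately show "weight_true (snd (pattern_of {P, V - P})) = card (H \<inter> P)"
    using assms card_split[OF assms(1)] by (simp add: pattern_of_eq)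
qed

text \<open>This depends on \<open>H\<close> only, so it can be compared across different
  labellings.\<close>

definition majority :: "'a set set \<Rightarrow> nat" where
  "majority c = Max ((\<lambda>P. card (H \<inter> P)) ` c)"

lemma majority_eq:
  assumes "P \<subseteq> V"
  shows "majority {P, V - P} = max (card (H \<inter> P)) (4 - card (H \<inter> P))"
  using card_split[OF assms] by (simp add: majority_def)

lemma pattern_of_in_patterns_from:
  assumes "c \<in> equal_partitions V" "n \<le> majority c"
  shows "pattern_of c \<in> set (patterns_from n)"
proof -
  obtain P where P: "r I1 \<in> P" "P \<subseteq> V" "card P = 4" "c = {P, V - P}"
    using equal_partition_obtain[OF assms(1)] by blast
  then have "pattern_of c \<in> set patterns"
    using weights_pattern_of[OF P(2,3,1)] by (auto simp: set_patterns pattern_of_eq)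
  then show ?thesis
    using assms(2) weights_pattern_of[OF P(2,3,1)] majority_eq[OF P(2)]
    by (simp add: patterns_from_def P(4))
qed

text \<open>An edge lies in the bipartite graph of \<open>c\<close> iff it crosses the partition;
  negating membership on the side \<open>A\<close> turns crossing into equality of the two
  entries.\<close>

lemma edge_in_Bc_edges_iff:
  assumes "c \<in> equal_partitions V"
  shows "edge i j \<in> Bc_edges c \<longleftrightarrow> fst (pattern_of c) i = snd (pattern_of c) j"
proof -
  obtain P where P: "r I1 \<in> P" "P \<subseteq> V" "c = {P, V - P}"
    using equal_partition_obtain[OF assms(1)] by blast
  then show ?thesis
    by (auto simp: pattern_of_eq edge_def Bc_edges_iff)
qed

lemma Bc_edges_subset_pairs:
  assumes "c \<in> equal_partitions V"
  shows "Bc_edges c \<subseteq> pairs V"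
proof
  fix e assume e: "e \<in> Bc_edges c"
  obtain P where P: "P \<subseteq> V" "c = {P, V - P}"
    using equal_partition_obtain[OF assms(1)] by blast
  obtain a b where ab: "e = {a, b}" using e by (auto simp: Bc_edges_def bip_edges_def)
  have "a \<in> V \<and> b \<in> V \<and> (a \<in> P) \<noteq> (b \<in> P)"
    using e P ab Bc_edges_iff by metis
  then show "e \<in> pairs V" unfolding pairs_def ab by blast
qed

section \<open>Perfect matchings as permutations\<close>

lemma perfect_matching_matching:
  assumes "c \<in> equal_partitions V" "inj q" "fits (pattern_of c) q"
  shows "perfect_matching V (Bc_edges c) (matching q)"
proof -
  have surj: "surj q" using assms(2) by (simp add: finite_UNIV_inj_surj)
  have "matching q \<subseteq> Bc_edges c"
    using assms by (auto simp: matching_def edge_in_Bc_edges_iff fits_def)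
  moreover have r: "\<exists>!e. e \<in> matching q \<and> r i \<in> e" for i
    by (rule ex1I[of _ "edge i (q i)"]) (auto simp: matching_def edge_def)
  moreover have s: "\<exists>!e. e \<in> matching q \<and> s j \<in> e" for j
  proof -
    obtain i where i: "q i = j" using surjD[OF surj, of j] by blast
    show ?thesis
    proof (rule ex1I[of _ "edge i j"])
      show "edge i j \<in> matching q \<and> s j \<in> edge i j"
        by (simp add: edge_in_matching_iff i) (simp add: edge_def)
      fix e assume e: "e \<in> matching q \<and> s j \<in> e"
      then obtain i' where i': "e = edge i' (q i')" unfolding matching_def by blast
      then have "q i' = q i" using e i by (simp add: edge_def)
      then have "i' = i" by (rule injD[OF assms(2)])
      then show "e = edge i j" using i i' by simp
    qed
  qed
  moreover have "\<exists>!e. e \<in> matching q \<and> v \<in> e" if "v \<in> V" for v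
    using that r s unfolding H_eq A_eq by (elim UnE rangeE) simp_all
  ultimately show ?thesis
    unfolding perfect_matching_def by (intro conjI ballI)
qed

text \<open>The edge of \<open>m\<close> at \<open>r i\<close> determines \<open>q i\<close>, and
  uniqueness of the edge at each \<open>s j\<close> makes \<open>q\<close> injective.\<close>

lemma perfect_matching_obtain:
  assumes "c \<in> equal_partitions V" "perfect_matching V (Bc_edges c) m" "m \<subseteq> bip_edges H A"
  obtains q where "inj q" "fits (pattern_of c) q" "m = matching q"
proof -
  have unique: "e = e'" if "e \<in> m" "e' \<in> m" "v \<in> e" "v \<in> e'" "v \<in> V" for e e' v
    using assms(2) that unfolding perfect_matching_def by blast
  have "\<exists>j. edge i j \<in> m" for i
  proof -
    have "r i \<in> V" by simp
    then obtain e where e: "e \<in> m" "r i \<in> e"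
      using assms(2) unfolding perfect_matching_def by blast
    then obtain i' j where "e = edge i' j" using assms(3) by (auto simp: bip_edges_eq)
    then show ?thesis using e by (auto simp: edge_def)
  qed
  then obtain q where q: "edge i (q i) \<in> m" for i by metis
  have "inj q"
  proof (rule injI)
    fix i i' assume "q i = q i'"
    then have "edge i (q i) = edge i' (q i')"
      using unique[OF q q, of "s (q i)" i i'] by (simp add: edge_def)
    then show "i = i'" by simp
  qed
  moreover have "fits (pattern_of c) q"
    using assms(1,2) q by (auto simp: fits_def perfect_matching_def simp flip: edge_in_Bc_edges_iff)
  moreover have "m = matching q"
  proof
    show "matching q \<subseteq> m" using q by (auto simp: matching_def)
    show "m \<subseteq> matching q"
    proof
      fix e assume e: "e \<in> m"
      then obtain i j where ij: "e = edge i j" using assms(3) by (auto simp: bip_edges_eq)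
      then have "e = edge i (q i)"
        using unique[OF e q, of "r i" i] by (simp add: edge_def)
      then show "e \<in> matching q" by (simp add: matching_def)
    qed
  qed
  ultimately show ?thesis using that by blast
qed

text \<open>Generators with positive coefficient use only edges between \<open>H\<close> and
  \<open>A\<close>, hence come from permutations. Pairing \<open>k * v\<close> with \<open>w\<close>
  on edges, where \<open>v\<close> is 1 throughout the grid, and with \<open>b\<close> on partitions
  gives the two identities.\<close>

lemma cone_decomposition:
  assumes v: "v \<in> sat_cone V (PM V)"
    and vE: "\<And>e. e \<in> pairs V \<Longrightarrow> v (Inl e) = (if e \<in> bip_edges H A then 1 else 0)"
  obtains k :: nat and S :: "('a coord \<Rightarrow> nat) set" and a Q C
  where "1 \<le> k" "finite S"
    "\<forall>m\<in>S. inj (Q m) \<and> C m \<in> equal_partitions V \<and> fits (pattern_of (C m)) (Q m)"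
    "\<forall>w. k * total_weight w = (\<Sum>m\<in>S. a m * weight w (Q m))"
    "\<forall>b. k * (\<Sum>c\<in>equal_partitions V. b c * v (Inr c)) = (\<Sum>m\<in>S. a m * b (C m))"
proof -
  obtain k S' a where k: "1 \<le> k" and S': "finite S'" "S' \<subseteq> PM V"
    and "(\<lambda>x. k * v x) = (\<lambda>x. \<Sum>m\<in>S'. a m * m x)"
    using v unfolding sat_cone_def int_cone_def by blast
  then have kv': "k * v x = (\<Sum>m\<in>S'. a m * m x)" for x by meson
  \<comment> \<open>A generator with coefficient 0 could contain edges inside \<open>H\<close> or
    inside \<open>A\<close>, so only positive coefficients are kept.\<close>
  define S where "S = {m \<in> S'. a m > 0}"
  have S: "finite S" using S' by (simp add: S_def)
  have kv: "k * v x = (\<Sum>m\<in>S. a m * m x)" for x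
    unfolding kv' S_def using S' by (intro sum.mono_neutral_right) auto
  have "\<exists>q c. inj q \<and> c \<in> equal_partitions V \<and> fits (pattern_of c) q \<and> m = chi_Ec (matching q) c"
    if m: "m \<in> S" for m
  proof -
    obtain c M where c: "c \<in> equal_partitions V" and M: "perfect_matching V (Bc_edges c) M"
      and m_eq: "m = chi_Ec M c"
      using m S' by (auto simp: S_def PM_def)
    have "M \<subseteq> bip_edges H A"
    proof
      fix e assume e: "e \<in> M"
      then have "e \<in> pairs V"
        using M Bc_edges_subset_pairs[OF c] by (auto simp: perfect_matching_def)
      \<comment> \<open>There is no cancellation: a positive contribution at \<open>e\<close> forces
        \<open>v\<close> to be nonzero there, so \<open>e\<close> belongs to the graph.\<close>
      moreover have "0 < a m * m (Inl e)"
        using m e by (simp add: S_def m_eq chi_Ec_def)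
      then have "0 < (\<Sum>m\<in>S. a m * m (Inl e))"
        by (intro sum_pos2[OF S m]) auto
      then have "v (Inl e) \<noteq> 0"
        using kv[of "Inl e"] by (metis mult_0_right less_irrefl)
      ultimately show "e \<in> bip_edges H A" using vE by (auto split: if_splits)
    qed
    then show ?thesis
      using perfect_matching_obtain[OF c M] c m_eq by metis
  qed
  then have "\<forall>m\<in>S. \<exists>q c. inj q \<and> c \<in> equal_partitions V
      \<and> fits (pattern_of c) q \<and> m = chi_Ec (matching q) c"
    by (rule ballI)
  then obtain Q where "\<forall>m\<in>S. \<exists>c. inj (Q m) \<and> c \<in> equal_partitions V
      \<and> fits (pattern_of c) (Q m) \<and> m = chi_Ec (matching (Q m)) c"
    by (rule bchoice[THEN exE])
  then obtain C where "\<forall>m\<in>S. inj (Q m) \<and> C m \<in> equal_partitions V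
      \<and> fits (pattern_of (C m)) (Q m) \<and> m = chi_Ec (matching (Q m)) (C m)"
    by (rule bchoice[THEN exE])
  then have QC: "inj (Q m) \<and> C m \<in> equal_partitions V \<and> fits (pattern_of (C m)) (Q m)"
    and m_eq: "m = chi_Ec (matching (Q m)) (C m)" if "m \<in> S" for m
    using that by blast+
  have m_edge: "m (Inl (edge i j)) = of_bool (Q m i = j)" if "m \<in> S" for m i j
    by (subst m_eq[OF that]) (simp add: chi_Ec_def edge_in_matching_iff)
  have m_part: "m (Inr c) = of_bool (c = C m)" if "m \<in> S" for m c
    by (subst m_eq[OF that]) (simp add: chi_Ec_def)
  have w_eq: "k * total_weight w = (\<Sum>m\<in>S. a m * weight w (Q m))" for w
  proof -
    have "v (Inl (edge i j)) = 1" for i j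
      using vE[OF edge_in_pairs] by (auto simp: bip_edges_eq)
    then have "k * total_weight w = (\<Sum>i\<in>UNIV. \<Sum>j\<in>UNIV. w i j * (k * v (Inl (edge i j))))"
      by (simp add: total_weight_def sum_list_idxs sum_distrib_left mult.commute)
    also have "\<dots> = (\<Sum>i\<in>UNIV. \<Sum>j\<in>UNIV. \<Sum>m\<in>S. w i j * (a m * m (Inl (edge i j))))"
      unfolding kv sum_distrib_left ..
    also have "\<dots> = (\<Sum>i\<in>UNIV. \<Sum>m\<in>S. \<Sum>j\<in>UNIV. w i j * (a m * m (Inl (edge i j))))"
      by (intro sum.cong refl sum.swap)
    also have "\<dots> = (\<Sum>m\<in>S. \<Sum>i\<in>UNIV. \<Sum>j\<in>UNIV. w i j * (a m * m (Inl (edge i j))))"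
      by (rule sum.swap)
    also have "\<dots> = (\<Sum>m\<in>S. a m * weight w (Q m))"
    proof (intro sum.cong refl)
      fix m assume m: "m \<in> S"
      have "(\<Sum>j\<in>UNIV. w i j * (a m * m (Inl (edge i j)))) = a m * w i (Q m i)" for i
        by (simp add: m_edge[OF m] of_bool_def if_distrib[of "\<lambda>x. _ * x"] cong: if_cong)
      then show "(\<Sum>i\<in>UNIV. \<Sum>j\<in>UNIV. w i j * (a m * m (Inl (edge i j)))) = a m * weight w (Q m)"
        by (simp add: weight_def sum_list_idxs sum_distrib_left)
    qed
    finally show ?thesis .
  qed
  have b_eq: "k * (\<Sum>c\<in>equal_partitions V. b c * v (Inr c)) = (\<Sum>m\<in>S. a m * b (C m))" for b
  proof -
    have "k * (\<Sum>c\<in>equal_partitions V. b c * v (Inr c)) = (\<Sum>c\<in>equal_partitions V. b c * (k * v (Inr c)))"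
      by (simp add: sum_distrib_left mult.left_commute)
    also have "\<dots> = (\<Sum>m\<in>S. \<Sum>c\<in>equal_partitions V. b c * (a m * m (Inr c)))"
      unfolding kv sum_distrib_left by (rule sum.swap)
    also have "\<dots> = (\<Sum>m\<in>S. a m * b (C m))"
    proof (intro sum.cong refl)
      fix m assume m: "m \<in> S"
      show "(\<Sum>c\<in>equal_partitions V. b c * (a m * m (Inr c))) = a m * b (C m)"
        using QC[OF m] finite_equal_partitions[OF finite_V]
        by (simp add: m_part[OF m] of_bool_def if_distrib[of "\<lambda>x. _ * x"] cong: if_cong)
    qed
    finally show ?thesis .
  qed
  show ?thesis
    using k S QC w_eq b_eq by (intro that ballI allI)
qed

text \<open>Use the constant weight 1: the grid has total 16 and each permutation has weight
  4.\<close>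

lemma sum_multiplicities:
  assumes v: "v \<in> sat_cone V (PM V)"
    and vE: "\<And>e. e \<in> pairs V \<Longrightarrow> v (Inl e) = (if e \<in> bip_edges H A then 1 else 0)"
  shows "(\<Sum>c\<in>equal_partitions V. v (Inr c)) = 4"
proof -
  obtain k :: nat and S :: "('a coord \<Rightarrow> nat) set" and a Q C where k: "1 \<le> k" and "finite S"
    and QC: "\<forall>m\<in>S. inj (Q m) \<and> C m \<in> equal_partitions V \<and> fits (pattern_of (C m)) (Q m)"
    and w: "\<forall>w. k * total_weight w = (\<Sum>m\<in>S. a m * weight w (Q m))"
    and b: "\<forall>b. k * (\<Sum>c\<in>equal_partitions V. b c * v (Inr c)) = (\<Sum>m\<in>S. a m * b (C m))"
    by (rule cone_decomposition[OF v vE]) (assumption, rule that)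
  have "total_weight (\<lambda>i j. 1) = 16" and "weight (\<lambda>i j. 1) q = 4" for q
    by (simp_all add: total_weight_def weight_def idxs_def)
  then have "k * 16 = (\<Sum>m\<in>S. a m) * 4"
    using w[rule_format, of "\<lambda>i j. 1"] by (simp add: sum_distrib_right)
  moreover have "k * (\<Sum>c\<in>equal_partitions V. v (Inr c)) = (\<Sum>m\<in>S. a m)"
    using b[rule_format, of "\<lambda>c. 1"] by simp
  ultimately have "k * (\<Sum>c\<in>equal_partitions V. v (Inr c)) = k * 4" by simp
  then show ?thesis using k by simp
qed

text \<open>Weak duality: bound each permutation in the decomposition of \<open>k * v\<close> by the
  value of \<open>b\<close> at its pattern, then cancel \<open>k\<close>.\<close>

lemma total_weight_le_sum_multiplicities:
  assumes v: "v \<in> sat_cone V (PM V)"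
    and vE: "\<And>e. e \<in> pairs V \<Longrightarrow> v (Inl e) = (if e \<in> bip_edges H A then 1 else 0)"
    and bound: "\<And>p q. inj q \<Longrightarrow> fits p q \<Longrightarrow> weight w q \<le> b p"
  shows "total_weight w \<le> (\<Sum>c\<in>equal_partitions V. b (pattern_of c) * v (Inr c))"
proof -
  obtain k :: nat and S :: "('a coord \<Rightarrow> nat) set" and a Q C where k: "1 \<le> k" and "finite S"
    and QC: "\<forall>m\<in>S. inj (Q m) \<and> C m \<in> equal_partitions V \<and> fits (pattern_of (C m)) (Q m)"
    and w: "\<forall>w. k * total_weight w = (\<Sum>m\<in>S. a m * weight w (Q m))"
    and b: "\<forall>b. k * (\<Sum>c\<in>equal_partitions V. b c * v (Inr c)) = (\<Sum>m\<in>S. a m * b (C m))"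
    by (rule cone_decomposition[OF v vE]) (assumption, rule that)
  have "k * total_weight w \<le> k * (\<Sum>c\<in>equal_partitions V. b (pattern_of c) * v (Inr c))"
    unfolding w[rule_format] b[rule_format, of "\<lambda>c. b (pattern_of c)"] using QC bound by (intro sum_mono mult_left_mono) auto
  then show ?thesis using k by simp
qed

lemma solvable_imp_in_int_cone:
  assumes v: "is_vec V v"
    and vE: "\<And>e. e \<in> pairs V \<Longrightarrow> v (Inl e) = (if e \<in> bip_edges H A then 1 else 0)"
    and mult: "\<And>b :: 'a set set \<Rightarrow> nat.
      (\<Sum>c\<in>equal_partitions V. b c * v (Inr c)) = b c0 + b c1 + b c2 + b c3"
    and part: "c0 \<in> equal_partitions V" "c1 \<in> equal_partitions V"
      "c2 \<in> equal_partitions V" "c3 \<in> equal_partitions V"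
    and solv: "solvable (pattern_of c0) (pattern_of c1) (pattern_of c2) (pattern_of c3)"
  shows "v \<in> int_cone (PM V)"
proof -
  obtain q0 q1 q2 q3 where inj: "inj q0" "inj q1" "inj q2" "inj q3"
    and fits: "fits (pattern_of c0) q0" "fits (pattern_of c1) q1"
      "fits (pattern_of c2) q2" "fits (pattern_of c3) q3"
    and avoids: "avoids q0 q1" "avoids q0 q2" "avoids q0 q3" "avoids q1 q2" "avoids q1 q3" "avoids q2 q3"
    using solv unfolding solvable_def by blast
  let ?m0 = "chi_Ec (matching q0) c0" and ?m1 = "chi_Ec (matching q1) c1"
    and ?m2 = "chi_Ec (matching q2) c2" and ?m3 = "chi_Ec (matching q3) c3"
  have PM: "chi_Ec (matching q) c \<in> PM V"
    if "c \<in> equal_partitions V" "inj q" "fits (pattern_of c) q" for c q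
    using perfect_matching_matching[OF that] that(1) unfolding PM_def by blast
  \<comment> \<open>The final 0 stands for the zero vector, to which the generators are added one at
    a time.\<close>
  have "v x = ?m0 x + (?m1 x + (?m2 x + (?m3 x + 0)))" for x
  proof (cases x)
    case (Inl e)
    show ?thesis
    proof (cases "e \<in> bip_edges H A")
      case True
      then obtain i j where e: "e = edge i j" by (auto simp: bip_edges_eq)
      have neq: "q0 i \<noteq> q1 i" "q0 i \<noteq> q2 i" "q0 i \<noteq> q3 i" "q1 i \<noteq> q2 i" "q1 i \<noteq> q3 i" "q2 i \<noteq> q3 i"
        using avoids by (simp_all add: avoids_def)
      then have "card {q0 i, q1 i, q2 i, q3 i} = 4" by simp
      \<comment> \<open>Four distinct columns in row \<open>i\<close> exhaust all columns, so each
        edge lies in exactly one of the four matchings.\<close>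
      then have "{q0 i, q1 i, q2 i, q3 i} = UNIV"
        by (intro card_seteq) (simp_all add: card_UNIV_idx)
      then have "j \<in> {q0 i, q1 i, q2 i, q3 i}" by simp
      moreover have "v x = 1" using True vE[OF edge_in_pairs] by (simp add: Inl e)
      ultimately show ?thesis
        using neq by (auto simp: Inl e chi_Ec_def edge_in_matching_iff)
    next
      case False
      then have "e \<notin> matching q" for q using matching_subset by blast
      moreover have "v x = 0"
      proof (cases "e \<in> pairs V")
        case True
        then show ?thesis using False vE by (simp add: Inl)
      next
        case False
        then show ?thesis using v by (auto simp: is_vec_def coords_def Inl)
      qed
      ultimately show ?thesis by (simp add: Inl chi_Ec_def)
    qed
  next
    case (Inr c)
    have "v x = of_bool (c = c0) + of_bool (c = c1) + of_bool (c = c2) + of_bool (c = c3)"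
    proof (cases "c \<in> equal_partitions V")
      case True
      then show ?thesis
        \<comment> \<open>The indicator of \<open>c\<close> extracts the single multiplicity at
          \<open>c\<close>.\<close>
        using mult[of "\<lambda>d. of_bool (c = d)"] finite_equal_partitions[OF finite_V]
        by (simp add: Inr of_bool_def if_distrib[of "\<lambda>x. x * _"] cong: if_cong)
    next
      case False
      then have "v x = 0" using v by (auto simp: is_vec_def coords_def Inr)
      then show ?thesis using False part by auto
    qed
    then show ?thesis by (simp add: Inr chi_Ec_def)
  qed
  then have "v = (\<lambda>x. ?m0 x + (?m1 x + (?m2 x + (?m3 x + 0))))" by blast
  then show ?thesis
    using PM inj fits part by (simp only: add_generator_in_int_cone zero_in_int_cone)
qed

end

section \<open>Normalisation and conclusion\<close>

lemma decided_staircase: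
  assumes "n \<in> {2, 3, 4}" "p1 \<in> set (patterns_from n)" "p2 \<in> set (patterns_from n)" "p3 \<in> set (patterns_from n)"
  shows "decided (staircase n) p1 p2 p3"
proof (rule check2D[OF _ assms(2-4)])
  show "check2 (staircase n) (deficits (staircase n) lines) (patterns_from n)"
    using assms(1) check_staircase_2 check_staircase_3 check_staircase_4 by blast
qed

theorem mainTheorem12:
  fixes V H A :: "'a set"
  assumes "finite V" and "H \<inter> A = {}" and "H \<union> A = V"
    and "card H = 4" and "card A = 4"
  shows "B_factorizable V (bip_edges H A)"
  unfolding B_factorizable_def
proof (intro conjI ballI impI)
  have fin: "finite H" "finite A" using assms by auto
  show "regular_graph V (bip_edges H A)"
    using regular_graph_bip_edges[OF fin assms(2)] assms by simp
  fix v assume v: "v \<in> sat_cone V (PM V)"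
    and "\<forall>e\<in>pairs V. v (Inl e) = (if e \<in> bip_edges H A then 1 else 0)"
  then have vE: "v (Inl e) = (if e \<in> bip_edges H A then 1 else 0)" if "e \<in> pairs V" for e
    using that by blast
  let ?C = "equal_partitions V"
  obtain r0 :: "idx \<Rightarrow> 'a" where "bij_betw r0 UNIV H" using enumerate_initial[OF assms(4)] by metis
  moreover obtain s0 :: "idx \<Rightarrow> 'a" where "bij_betw s0 UNIV A" using enumerate_initial[OF assms(5)] by metis
  ultimately interpret L0: labelled_K44 H A r0 s0
    using assms(2) by unfold_locales
  obtain cs where cs: "set cs \<subseteq> ?C"
    and "\<forall>b :: 'a set set \<Rightarrow> nat. (\<Sum>c\<in>?C. b c * v (Inr c)) = (\<Sum>c\<leftarrow>cs. b c)"
    using exists_list_of_multiplicities[OF finite_equal_partitions[OF assms(1)], of "\<lambda>c. v (Inr c)"] by blast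
  then have mult: "(\<Sum>c\<in>?C. b c * v (Inr c)) = (\<Sum>c\<leftarrow>cs. b c)" for b :: "'a set set \<Rightarrow> nat"
    by blast
  have len: "length cs = 4"
    using mult[of "\<lambda>c. 1"] L0.sum_multiplicities v vE assms(3) by (simp add: sum_list_triv)
  \<comment> \<open>Minimality of the majority places the patterns of the other three partitions in
    \<open>patterns_from n\<close>, the range covered by the evaluation.\<close>
  define c0 where "c0 = arg_min_list L0.majority cs"
  have "cs \<noteq> []" using len by auto
  then have "c0 \<in> set cs" and min: "\<And>c. c \<in> set cs \<Longrightarrow> L0.majority c0 \<le> L0.majority c"
    by (simp_all add: c0_def arg_min_list_in f_arg_min_list_f)
  then obtain xs ys where xy: "cs = xs @ c0 # ys" by (meson split_list)
  with len have "length (xs @ ys) = 3" by simp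
  then obtain c1 c2 c3 where rest: "xs @ ys = [c1, c2, c3]"
    unfolding numeral_3_eq_3 length_Suc_conv length_0_conv by blast
  have "(\<Sum>c\<leftarrow>cs. b c) = b c0 + (\<Sum>c\<leftarrow>xs @ ys. b c)" for b :: "'a set set \<Rightarrow> nat"
    by (simp add: xy)
  then have mult': "(\<Sum>c\<in>?C. b c * v (Inr c)) = b c0 + b c1 + b c2 + b c3" for b :: "'a set set \<Rightarrow> nat"
    by (simp add: mult rest)
  have "set cs = {c0, c1, c2, c3}"
    using arg_cong[OF rest, of set] by (auto simp: xy)
  with cs min have part: "c0 \<in> ?C" "c1 \<in> ?C" "c2 \<in> ?C" "c3 \<in> ?C"
    and maj: "L0.majority c0 \<le> L0.majority c1" "L0.majority c0 \<le> L0.majority c2" "L0.majority c0 \<le> L0.majority c3"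
    by auto
  define n where "n = L0.majority c0"
  \<comment> \<open>The majority is attained at one of the two parts; that part is called
    \<open>P\<close>, passing to the complement if necessary.\<close>
  obtain P where P: "P \<subseteq> V" "card P = 4" "c0 = {P, V - P}" "card (H \<inter> P) = n"
  proof -
    obtain P where P: "P \<subseteq> V" "card P = 4" "c0 = {P, V - P}"
      using L0.equal_partition_obtain[of c0] part(1) assms(3) by metis
    have n: "n = max (card (H \<inter> P)) (4 - card (H \<inter> P))"
      using L0.majority_eq[of P] P assms(3) by (simp add: n_def)
    have "finite P" using P(1) assms(1) by (rule finite_subset)
    then have VP: "card (V - P) = 4"
      using card_Diff_subset[of P V] P(1,2) L0.card_V assms(3) by simp
    have HVP: "card (H \<inter> (V - P)) = 4 - card (H \<inter> P)"
      using L0.card_split(3)[of P] P(1) assms(3) by simp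
    have "V - (V - P) = P" using P(1) by blast
    then have c0': "c0 = {V - P, V - (V - P)}" using P(3) by (simp add: insert_commute)
    show ?thesis
    proof (cases "card (H \<inter> P) = n")
      case True
      then show ?thesis by (rule that[OF P])
    next
      case False
      then have "card (H \<inter> (V - P)) = n" using n HVP by (simp add: max_def split: if_splits)
      then show ?thesis by (rule that[OF Diff_subset VP c0'])
    qed
  qed
  have "card (H \<inter> P) \<le> 4" using card_mono[OF fin(1), of "H \<inter> P"] assms(4) by simp
  then have "n \<le> 4" by (simp only: P(4))
  moreover have "max n (4 - n) = n"
    using L0.majority_eq[of P] P(1,3,4) assms(3) by (simp add: n_def)
  then have "4 - n \<le> n" by linarith
  ultimately have "n = 2 \<or> n = 3 \<or> n = 4" by linarith
  then have n: "n \<in> {2, 3, 4}" by simp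
  \<comment> \<open>Relabelling so that the first \<open>n\<close> labels of \<open>H\<close> lie
    inside \<open>P\<close> and the first \<open>n\<close> labels of \<open>A\<close> lie outside
    \<open>P\<close> makes the pattern of \<open>c0\<close> the staircase.\<close>
  obtain r :: "idx \<Rightarrow> 'a" where r: "bij_betw r UNIV H" "\<And>i. r i \<in> P \<longleftrightarrow> position i < n"
    using enumerate_initial[OF assms(4), of P] P(4) by metis
  have "card (A \<inter> - P) = n"
    using L0.card_split[of P] P assms(3) \<open>card (H \<inter> P) \<le> 4\<close> by simp
  then obtain s :: "idx \<Rightarrow> 'a" where s: "bij_betw s UNIV A" "\<And>i. s i \<in> - P \<longleftrightarrow> position i < n"
    using enumerate_initial[OF assms(5), of "- P"] by metis
  interpret labelled_K44 H A r s
    using assms(2) r(1) s(1) by unfold_locales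
  have V: "H \<union> A = V" by (fact assms(3))
  \<comment> \<open>As \<open>n\<close> is positive, \<open>P\<close> is the part that
    \<open>pattern_of\<close> reads.\<close>
  have "r I1 \<in> P" using r(2)[of I1] n by (auto simp: position_def)
  then have c0: "pattern_of c0 = staircase n"
    using pattern_of_eq[of P] P r(2) s(2) V by (simp add: staircase_position)
  have "decided (pattern_of c0) (pattern_of c1) (pattern_of c2) (pattern_of c3)"
    unfolding c0 using n maj part pattern_of_in_patterns_from
    by (intro decided_staircase) (auto simp: n_def V)
  moreover have "\<not> obstructed (pattern_of c0) (pattern_of c1) (pattern_of c2) (pattern_of c3)"
  proof
    assume "obstructed (pattern_of c0) (pattern_of c1) (pattern_of c2) (pattern_of c3)"
    then obtain w b where bound: "\<And>p q. inj q \<Longrightarrow> fits p q \<Longrightarrow> weight w q \<le> b p"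
      and less: "b (pattern_of c0) + b (pattern_of c1) + b (pattern_of c2) + b (pattern_of c3) < total_weight w"
      unfolding obstructed_def by blast
    \<comment> \<open>Duality bounds the total weight by the sum of the four values of
      \<open>b\<close>, contradicting the obstruction.\<close>
    have "total_weight w \<le> (\<Sum>c\<in>?C. b (pattern_of c) * v (Inr c))"
      using total_weight_le_sum_multiplicities[of v w b] v vE bound V by simp
    then show False using less mult'[of "\<lambda>c. b (pattern_of c)"] by simp
  qed
  ultimately have "solvable (pattern_of c0) (pattern_of c1) (pattern_of c2) (pattern_of c3)"
    by (simp add: decided_def)
  then show "v \<in> int_cone (PM V)"
    using solvable_imp_in_int_cone[of v c0 c1 c2 c3] v vE mult' part V by (simp add: sat_cone_def)
qed

end
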